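(* For $x,y\in\mathbb{R}$ let $$R_{ab}(x,y)=\sup\left\{\frac{p_1+p_2+1}{q}\ \middle|\ p_1,p_2\in\mathbb{Z},\ q\in\mathbb{Z}_{>0},\ \frac{p_1}{q}\le x,\ \frac{p_2}{q}\le y\right\},$$ and let $$\mathcal{Z}=\{(x,y,z)\in[0,1)^3 \mid 0\le z\le R_{ab}(1-x,1-y)-1\}.$$ For $a,b,c\ge 0$ put $\Pi(a,b,c)=[0,a]\times[0,b]\times[0,c]$, and let $$\widetilde{\mathcal{Z}}=\bigcup_{\substack{0<a<m\\ \gcd(a,m)=1}}\left[\Pi\left(\tfrac{a}{m},\tfrac{m-a}{m},\tfrac1m\right)\cup\Pi\left(\tfrac{a}{m},\tfrac1m,\tfrac{m-a}{m}\right)\cup\Pi\left(\tfrac1m,\tfrac{a}{m},\tfrac{m-a}{m}\right)\right],$$ the union being over all coprime integers $a,m$ with $0<a<m$. Then $$\mathcal{Z}=\widetilde{\mathcal{Z}}.$$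
   Context: This expresses the equivalence of two descriptions of the Jankins--Neumann ziggurat: the one by the Calegari--Walker formula for $R_{ab}$ (here taken as the definition of $R_{ab}$), and the one by the Jankins--Neumann list of parallelepipeds $\widetilde{\mathcal{Z}}$.
   Formalization: The stated equality fails where a coordinate is 0: (9/10, 9/10, 0) lies in Z but not in Z̃. What is proved is that Z equals Z̃ together with all points of [0,1)³ with x=0, y=0 or z=0; so Z = Z̃ on points with x,y,z>0, and Z̃ ⊆ Z. *)

theory Defs
  imports Complex_Main
begin

definition R_ab_set :: "real \<Rightarrow> real \<Rightarrow> real set" where
  "R_ab_set x y = {(of_int p1 + of_int p2 + 1) / of_int q | (p1::int) (p2::int) (q::int).
     q > 0 \<and> of_int p1 / of_int q \<le> x \<and> of_int p2 / of_int q \<le> y}"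

definition R_ab :: "real \<Rightarrow> real \<Rightarrow> real" where
  "R_ab x y = Sup (R_ab_set x y)"

text \<open>On the reals, \<^const>\<open>Sup\<close> is only meaningful for nonempty sets that are bounded above.\<close>

lemma R_ab_set_nonempty: "R_ab_set x y \<noteq> {}"
proof -
  have "(of_int \<lfloor>x\<rfloor> + of_int \<lfloor>y\<rfloor> + 1) / of_int 1 \<in> R_ab_set x y"
    unfolding R_ab_set_def by (intro CollectI exI conjI) (rule refl, auto)
  then show ?thesis by blast
qed

lemma R_ab_set_bdd_above: "bdd_above (R_ab_set x y)"
proof (rule bdd_aboveI)
  fix r assume "r \<in> R_ab_set x y"
  then obtain p1 p2 q :: int where q: "q > 0"
    and r: "r = (of_int p1 + of_int p2 + 1) / of_int q"
    and p: "of_int p1 / of_int q \<le> x" "of_int p2 / of_int q \<le> y"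
    unfolding R_ab_set_def by blast
  have "1 / real_of_int q \<le> 1" using q by simp
  then show "r \<le> x + y + 1" using p r by (simp add: add_divide_distrib)
qed

definition ziggurat :: "(real \<times> real \<times> real) set" where
  "ziggurat = {(x, y, z). (x, y, z) \<in> {0..<1} \<times> {0..<1} \<times> {0..<1} \<and>
     0 \<le> z \<and> z \<le> R_ab (1 - x) (1 - y) - 1}"

definition box :: "real \<Rightarrow> real \<Rightarrow> real \<Rightarrow> (real \<times> real \<times> real) set" where
  "box a b c = {0..a} \<times> {0..b} \<times> {0..c}"

definition JN_ziggurat :: "(real \<times> real \<times> real) set" where
  "JN_ziggurat = (\<Union>(a, m) \<in> {(a, m). (0::int) < a \<and> a < m \<and> coprime a m}.
       box (of_int a / of_int m) (of_int (m - a) / of_int m) (1 / of_int m)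
     \<union> box (of_int a / of_int m) (1 / of_int m) (of_int (m - a) / of_int m)
     \<union> box (1 / of_int m) (of_int a / of_int m) (of_int (m - a) / of_int m))"

text \<open>
  Read literally, the equality of the two sets fails, but only on the coordinate planes:
  every point of the half-open unit cube with a vanishing coordinate lies in
  \<^const>\<open>ziggurat\<close>, whereas any two coordinates of a point of \<^const>\<open>JN_ziggurat\<close>
  add up to at most 1. A concrete witness is the point (9/10, 9/10, 0).
\<close>

lemma ziggurat_neq_JN_ziggurat: "ziggurat \<noteq> JN_ziggurat"
proof -
  let ?P = "(9/10, 9/10, 0) :: real \<times> real \<times> real"
  have "(of_int 0 + of_int 0 + 1) / of_int 1 \<in> R_ab_set (1 - 9/10) (1 - 9/10)"
    unfolding R_ab_set_def by (intro CollectI exI conjI) (rule refl, auto)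
  then have "1 \<le> R_ab (1 - 9/10) (1 - 9/10)"
    unfolding R_ab_def using cSup_upper[OF _ R_ab_set_bdd_above] by fastforce
  then have "?P \<in> ziggurat" by (simp add: ziggurat_def)
  moreover have "?P \<notin> JN_ziggurat"
  proof
    assume "?P \<in> JN_ziggurat"
    then obtain a m :: int where am: "0 < a" "a < m"
      and "?P \<in> box (a / m) (of_int (m - a) / m) (1 / m)
        \<union> box (a / m) (1 / m) (of_int (m - a) / m)
        \<union> box (1 / m) (a / m) (of_int (m - a) / m)"
      unfolding JN_ziggurat_def by auto
    then have "9/10 \<le> a / real_of_int m \<and> 9/10 \<le> (real_of_int m - a) / m
        \<or> 9/10 \<le> a / real_of_int m \<and> 9/10 \<le> 1 / real_of_int m"
      unfolding box_def by auto
    moreover have "real_of_int m > 0" "real_of_int m \<ge> 2" using am by linarith+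
    ultimately show False by (auto simp: field_simps)
  qed
  ultimately show ?thesis by blast
qed

end

theory Submission
  imports Defs
begin

text \<open>
  Substituting \<open>p\<^sub>1 = q - u\<close> and \<open>p\<^sub>2 = q - v\<close> turns the Calegari--Walker formula into a
  statement symmetric in three variables: up to attainment of the supremum, a point with positive
  coordinates lies in the ziggurat iff it lies in a box with corner \<open>(u/q, v/q, w/q)\<close>, where
  \<open>u, v, w\<close> are positive integers with \<open>u + v + w = q + 1\<close>. The Jankins--Neumann boxes are
  those with \<open>min u v w = 1\<close>. Conversely, if \<open>w\<close> is the least of the three, a Stern--Brocot search
  finds a fraction \<open>k/m\<close> in the interval \<open>[u/q, (u + w - 1)/q]\<close> with \<open>m \<le> q/w\<close>, and then the
  box with corner \<open>(k/m, (m - k)/m, 1/m)\<close> contains the given one. The supremum causes no trouble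
  because only finitely many Jankins--Neumann boxes meet the region where all coordinates are
  bounded below by a positive constant.
\<close>

section \<open>Stern-Brocot search for a fraction of small denominator\<close>

text \<open>\<open>a/b\<close> and \<open>c/d\<close> are Farey neighbours strictly enclosing the
  target interval \<open>[u/q, (u + w - 1)/q]\<close>. Their mediant either hits the interval or
  replaces the end on its own side, which keeps the determinant 1.\<close>

lemma stern_brocot_search:
  fixes a b c d u v w q :: int
  assumes "0 \<le> a" "0 < b" "0 < d" "c \<le> d" "b * c - a * d = 1"
    and "a * q < u * b" "(u + w - 1) * d < c * q"
    and "1 \<le> w" "w \<le> u" "w \<le> v" "u + v + w = q + 1"
  shows "\<exists>k m. 0 < m \<and> m * w \<le> q \<and> u * m \<le> k * q \<and> k * q \<le> (u + w - 1) * m"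
  using assms(1-7)
proof (induction "nat (q + 1 - b - d)" arbitrary: a b c d rule: less_induct)
  case less
  \<comment> \<open>Up to the factors \<open>q * b\<close> and \<open>q * d\<close>, these are the
    gaps between the interval and the two neighbours. As positive integers they are at least
    1.\<close>
  define e f where "e = u * b - a * q" and "f = c * q - (u + w - 1) * d"
  have ef: "1 \<le> e" "1 \<le> f" using less.prems by (simp_all add: e_def f_def)
  \<comment> \<open>The distance \<open>1/(b * d)\<close> of the neighbours is the sum of the two
    gaps and the length \<open>(w - 1)/q\<close>, here multiplied by
    \<open>b * d * q\<close>.\<close>
  have "q * (b * c - a * d) = d * e + b * f + b * d * (w - 1)"
    by (simp add: e_def f_def algebra_simps)
  then have q: "q = d * e + b * f + b * d * (w - 1)" using less.prems by simp
  have de: "d * 1 \<le> d * e" and bf: "b * 1 \<le> b * f"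
    using ef less.prems by (intro mult_left_mono; simp)+
  have uq: "u \<le> q" "q > 0" using assms by linarith+
  txt \<open>This bound makes every mediant met an admissible answer and also makes the search end.\<close>
  have le: "(b + d) * w \<le> q"
  proof -
    \<comment> \<open>If both denominators are at least 2, then \<open>b + d <= b * d\<close> and
      gaps of 1 suffice. Otherwise a neighbour is still 0/1 or 1/1, its gap is \<open>u\<close> or
      \<open>v\<close>, and minimality of \<open>w\<close> gives the bound.\<close>
    consider "b = 1" | "d = 1" | "b \<ge> 2" "d \<ge> 2" using less.prems by linarith
    then show ?thesis
    proof cases
      case 1
      have "a < 1"
      proof (rule ccontr)
        assume "\<not> a < 1"
        then have "1 * q \<le> a * q" using uq by (intro mult_right_mono) auto
        moreover have "a * q < u" using less.prems 1 by simp
        ultimately show False using uq by linarith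
      qed
      then have "e = u" using less.prems 1 by (simp add: e_def)
      then have "d * w \<le> d * e" using assms less.prems by simp
      moreover have "1 * (w - 1) \<le> d * (w - 1)"
        using assms less.prems by (intro mult_right_mono) auto
      ultimately show ?thesis using q ef 1 by (simp add: algebra_simps)
    next
      case 2
      have "c \<ge> 1"
      proof (rule ccontr)
        assume "\<not> c \<ge> 1"
        then have "c * q \<le> 0" using uq by (simp add: mult_nonpos_nonneg)
        then show False using less.prems 2 assms by simp
      qed
      then have "f = v" using less.prems 2 assms by (simp add: f_def)
      then have "b * w \<le> b * f" using assms less.prems by simp
      moreover have "1 * (w - 1) \<le> b * (w - 1)"
        using assms less.prems by (intro mult_right_mono) auto
      ultimately show ?thesis using q ef 2 by (simp add: algebra_simps)
    next
      case 3
      have "0 \<le> (b - 1) * (d - 1) - 1"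
        using mult_mono[of 1 "b - 1" 1 "d - 1"] 3 by simp
      then have "b + d \<le> b * d" by (simp add: algebra_simps)
      then have "(b + d) * (w - 1) \<le> b * d * (w - 1)"
        using assms by (intro mult_right_mono) auto
      then show ?thesis using q de bf by (simp add: algebra_simps)
    qed
  qed
  have "b + d \<le> (b + d) * w"
    using mult_left_mono[of 1 w "b + d"] assms less.prems by simp
  then have bdq: "b + d \<le> q" using le by linarith
  consider "(a + c) * q < u * (b + d)" | "(u + w - 1) * (b + d) < (a + c) * q"
    | "u * (b + d) \<le> (a + c) * q" "(a + c) * q \<le> (u + w - 1) * (b + d)" by linarith
  then show ?case
  proof cases
    case 1
    \<comment> \<open>This keeps the numerator \<open>a + c\<close> of the new left end nonnegative.
      By \<open>bdq\<close> the measure is still positive, so it strictly drops.\<close>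
    have "0 < c"
    proof (rule ccontr)
      assume "\<not> 0 < c"
      then have "c * q \<le> 0" using uq by (simp add: mult_nonpos_nonneg)
      moreover have "0 \<le> (u + w - 1) * d" using assms less.prems by simp
      ultimately show False using less.prems by linarith
    qed
    with 1 show ?thesis
      using less.prems bdq by (intro less.hyps[of "b + d" d "a + c" c]) (simp_all add: algebra_simps)
  next
    case 2
    \<comment> \<open>Together with \<open>c <= d\<close> this keeps the new right end at most
      1.\<close>
    have "a < b"
    proof (rule ccontr)
      assume "\<not> a < b"
      then have "b * q \<le> a * q" using uq by (intro mult_right_mono) auto
      moreover have "u * b \<le> b * q" using uq less.prems by simp
      ultimately show False using less.prems(6) by linarith
    qed
    with 2 show ?thesis
      using less.prems bdq by (intro less.hyps[of b "b + d" a "a + c"]) (simp_all add: algebra_simps)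
  next
    case 3
    then show ?thesis using le less.prems by (intro exI[of _ "a + c"] exI[of _ "b + d"]) simp
  qed
qed

lemma corner_le_coprime_corner:
  fixes u v w q :: int
  assumes "1 \<le> w" "w \<le> u" "w \<le> v" "u + v + w = q + 1"
  obtains a m :: int where "0 < a" "a < m" "coprime a m"
    "u / real_of_int q \<le> a / real_of_int m" "v / real_of_int q \<le> of_int (m - a) / real_of_int m"
    "w / real_of_int q \<le> 1 / real_of_int m"
proof -
  have q: "q > 0" using assms by linarith
  \<comment> \<open>The search starts from 0/1 and 1/1, which enclose the interval strictly because
    \<open>u\<close> and \<open>v\<close> are positive.\<close>
  obtain k n :: int where n: "0 < n" "n * w \<le> q" "u * n \<le> k * q" "k * q \<le> (u + w - 1) * n"
    using stern_brocot_search[of 0 1 1 1 q u w v] assms by auto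
  have "0 < u * n" using assms n by simp
  then have "0 < k * q" using n by linarith
  then have k: "0 < k" using q by (simp add: zero_less_mult_iff)
  \<comment> \<open>Reduction to lowest terms only shrinks the denominator, so the bound on it
    survives.\<close>
  define g where "g = gcd k n"
  have g: "g > 0" using k by (simp add: g_def)
  obtain a m where am: "k = a * g" "n = m * g" "coprime a m"
    using gcd_coprime_exists[of k n] g unfolding g_def by auto
  have m: "m > 0" and a: "a > 0" using am n k g by (simp_all add: zero_less_mult_iff)
  have 1: "u * m \<le> a * q"
  proof -
    have "g * (u * m) \<le> g * (a * q)" using n(3) by (simp add: am algebra_simps)
    then show ?thesis using g by simp
  qed
  \<comment> \<open>The right end of the interval is \<open>1 - v/q\<close>, so lying below it
    bounds \<open>v/q\<close> by the complementary fraction.\<close>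
  have 2: "a * q \<le> (q - v) * m"
  proof -
    have "g * (a * q) \<le> g * ((u + w - 1) * m)" using n(4) by (simp add: am algebra_simps)
    moreover have "u + w - 1 = q - v" using assms by simp
    ultimately show ?thesis using g by simp
  qed
  have 3: "m * w \<le> q"
  proof -
    have "m * w * 1 \<le> m * w * g" using m g assms by (intro mult_left_mono) auto
    then show ?thesis using n(2) by (simp add: am mult.commute mult.left_commute)
  qed
  have "a * q < q * m"
  proof -
    have "0 < v * m" using assms m by simp
    then show ?thesis using 2 by (simp add: left_diff_distrib)
  qed
  then have am_lt: "a < m" using q by (simp add: mult.commute)
  have r: "real_of_int u * m \<le> a * real_of_int q"
    "real_of_int v * m \<le> of_int (m - a) * real_of_int q" "real_of_int m * w \<le> q"
    using 1 2 3 by (simp_all flip: of_int_mult add: algebra_simps)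
  show thesis
    by (rule that[OF a am_lt am(3)]) (use r q m in \<open>simp_all add: divide_simps mult.commute\<close>)
qed

section \<open>Boxes with numerator sum q + 1\<close>

lemma box_subset_JN_ziggurat:
  assumes "0 < a" "a < m" "coprime a m"
  shows "box (of_int a / of_int m) (of_int (m - a) / of_int m) (1 / of_int m) \<subseteq> JN_ziggurat"
    "box (of_int a / of_int m) (1 / of_int m) (of_int (m - a) / of_int m) \<subseteq> JN_ziggurat"
    "box (1 / of_int m) (of_int a / of_int m) (of_int (m - a) / of_int m) \<subseteq> JN_ziggurat"
  using assms unfolding JN_ziggurat_def by blast+

lemma box_mono: "a \<le> a' \<Longrightarrow> b \<le> b' \<Longrightarrow> c \<le> c' \<Longrightarrow> box a b c \<subseteq> box a' b' c'"
  by (auto simp: box_def)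

text \<open>The position of the least numerator selects which of the three families of boxes is
  used: that coordinate gets the edge \<open>1/m\<close>.\<close>

lemma unit_excess_box_subset_JN_ziggurat:
  fixes u v w q :: int
  assumes "1 \<le> u" "1 \<le> v" "1 \<le> w" "u + v + w = q + 1"
  shows "box (of_int u / of_int q) (of_int v / of_int q) (of_int w / of_int q) \<subseteq> JN_ziggurat"
proof -
  consider "w \<le> u" "w \<le> v" | "v \<le> u" "v \<le> w" | "u \<le> v" "u \<le> w" by linarith
  then show ?thesis
  proof cases
    case 1
    have eq: "u + v + w = q + 1" using assms by simp
    obtain a m :: int where am: "0 < a" "a < m" "coprime a m"
      "u / real_of_int q \<le> a / real_of_int m"
      "v / real_of_int q \<le> of_int (m - a) / real_of_int m"
      "w / real_of_int q \<le> 1 / real_of_int m"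
      by (rule corner_le_coprime_corner[OF assms(3) 1 eq])
    show ?thesis
      by (rule order_trans[OF box_mono[OF am(4-6)] box_subset_JN_ziggurat(1)[OF am(1-3)]])
  next
    case 2
    have eq: "u + w + v = q + 1" using assms by simp
    obtain a m :: int where am: "0 < a" "a < m" "coprime a m"
      "u / real_of_int q \<le> a / real_of_int m"
      "w / real_of_int q \<le> of_int (m - a) / real_of_int m"
      "v / real_of_int q \<le> 1 / real_of_int m"
      by (rule corner_le_coprime_corner[OF assms(2) 2 eq])
    show ?thesis
      by (rule order_trans[OF box_mono[OF am(4,6,5)] box_subset_JN_ziggurat(2)[OF am(1-3)]])
  next
    case 3
    have eq: "v + w + u = q + 1" using assms by simp
    obtain a m :: int where am: "0 < a" "a < m" "coprime a m"
      "v / real_of_int q \<le> a / real_of_int m"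
      "w / real_of_int q \<le> of_int (m - a) / real_of_int m"
      "u / real_of_int q \<le> 1 / real_of_int m"
      by (rule corner_le_coprime_corner[OF assms(1) 3 eq])
    show ?thesis
      by (rule order_trans[OF box_mono[OF am(6,4,5)] box_subset_JN_ziggurat(3)[OF am(1-3)]])
  qed
qed

section \<open>Translating the supremum into boxes\<close>

lemma R_ab_ge:
  fixes u v q :: int
  assumes "q > 0" "x \<le> u / real_of_int q" "y \<le> v / real_of_int q"
  shows "of_int (q + 1 - u - v) / of_int q \<le> R_ab (1 - x) (1 - y) - 1"
proof -
  have "(of_int (q - u) + of_int (q - v) + 1) / of_int q \<in> R_ab_set (1 - x) (1 - y)"
    unfolding R_ab_set_def
    by (intro CollectI exI conjI) (rule refl, use assms in \<open>auto simp: diff_divide_distrib\<close>)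
  then have "(of_int (q - u) + of_int (q - v) + 1) / of_int q \<le> R_ab (1 - x) (1 - y)"
    unfolding R_ab_def by (rule cSup_upper[OF _ R_ab_set_bdd_above])
  then show ?thesis using assms by (simp add: field_simps)
qed

text \<open>A value strictly below the supremum is exceeded by some member of the set; strictness
  avoids any appeal to attainment.\<close>

lemma less_R_abE:
  assumes "z < R_ab (1 - x) (1 - y) - 1"
  obtains u v q :: int where "q > 0" "x \<le> u / real_of_int q" "y \<le> v / real_of_int q"
    "z < of_int (q + 1 - u - v) / of_int q"
proof -
  have "z + 1 < Sup (R_ab_set (1 - x) (1 - y))" using assms by (simp add: R_ab_def)
  then obtain r where "r \<in> R_ab_set (1 - x) (1 - y)" "z + 1 < r"
    by (rule less_cSupE[OF _ R_ab_set_nonempty])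
  then obtain p1 p2 q :: int where q: "q > 0" and r: "z + 1 < (of_int p1 + of_int p2 + 1) / of_int q"
    and p: "of_int p1 / of_int q \<le> 1 - x" "of_int p2 / of_int q \<le> 1 - y"
    unfolding R_ab_set_def by blast
  have "of_int (q + 1 - (q - p1) - (q - p2)) / of_int q = (of_int p1 + of_int p2 + 1) / of_int q - (1::real)"
    using q by (simp add: field_simps)
  moreover have "of_int (q - p) / of_int q = 1 - of_int p / (of_int q :: real)" for p
    using q by (simp add: diff_divide_distrib)
  ultimately show thesis
    using p q r by (intro that[of q "q - p1" "q - p2"]) simp_all
qed

lemma in_JN_ziggurat_if_less:
  assumes "0 < x" "0 < y" "0 < z" "z < R_ab (1 - x) (1 - y) - 1"
  shows "(x, y, z) \<in> JN_ziggurat"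
proof -
  obtain u v q :: int where *: "q > 0" "x \<le> u / real_of_int q" "y \<le> v / real_of_int q"
    "z < of_int (q + 1 - u - v) / of_int q"
    by (rule less_R_abE[OF assms(4)])
  \<comment> \<open>Positivity of the coordinates forces all three integer numerators to be at least
    1.\<close>
  have "0 < u / real_of_int q" "0 < v / real_of_int q" "0 < of_int (q + 1 - u - v) / real_of_int q"
    using * assms by linarith+
  then have "0 < real_of_int u" "0 < real_of_int v" "0 < real_of_int (q + 1 - u - v)"
    using *(1) by (simp_all add: zero_less_divide_iff)
  then have "1 \<le> u" "1 \<le> v" "1 \<le> q + 1 - u - v" by linarith+
  from unit_excess_box_subset_JN_ziggurat[OF this, of q]
  have "box (of_int u / of_int q) (of_int v / of_int q) (of_int (q + 1 - u - v) / of_int q) \<subseteq> JN_ziggurat"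
    by simp
  then show ?thesis by (rule subsetD) (use * assms(1-3) in \<open>simp add: box_def\<close>)
qed

section \<open>Closing up under limits in the third coordinate\<close>

text \<open>Lifting a point to the top of its box leaves only finitely many possible heights once
  all coordinates are at least \<open>e\<close>.\<close>

lemma JN_ziggurat_raise:
  assumes "(x, y, z) \<in> JN_ziggurat" "0 < e" "e \<le> x" "e \<le> y" "e \<le> z"
  obtains a m :: int and c where "a \<in> {0..\<lceil>1 / e\<rceil>}" "m \<in> {0..\<lceil>1 / e\<rceil>}"
    "c \<in> {1 / of_int m, of_int (m - a) / of_int m}" "z \<le> c" "(x, y, c) \<in> JN_ziggurat"
proof -
  obtain a m :: int where am: "0 < a" "a < m" "coprime a m"
    and "(x, y, z) \<in> box (of_int a / of_int m) (of_int (m - a) / of_int m) (1 / of_int m)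
      \<union> box (of_int a / of_int m) (1 / of_int m) (of_int (m - a) / of_int m)
      \<union> box (1 / of_int m) (of_int a / of_int m) (of_int (m - a) / of_int m)"
    using assms(1) unfolding JN_ziggurat_def by blast
  then consider (1) "(x, y, z) \<in> box (of_int a / of_int m) (of_int (m - a) / of_int m) (1 / of_int m)"
    | (2) "(x, y, z) \<in> box (of_int a / of_int m) (1 / of_int m) (of_int (m - a) / of_int m)"
    | (3) "(x, y, z) \<in> box (1 / of_int m) (of_int a / of_int m) (of_int (m - a) / of_int m)" by blast
  note cs = this
  \<comment> \<open>Each kind of box has one edge \<open>1/m\<close>, so the lower bound on the
    coordinates bounds \<open>m\<close>.\<close>
  have "e \<le> 1 / of_int m" by (rule cs) (use assms(3-5) in \<open>auto simp: box_def\<close>)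
  then have "of_int m \<le> 1 / e" using am(1,2) assms(2) by (simp add: le_divide_eq mult.commute)
  then have m: "m \<le> \<lceil>1 / e\<rceil>" by (simp add: le_ceiling_iff)
  note sub = box_subset_JN_ziggurat[OF am]
  show thesis
  proof (rule cs)
    assume 1: "(x, y, z) \<in> box (of_int a / of_int m) (of_int (m - a) / of_int m) (1 / of_int m)"
    then have "(x, y, 1 / of_int m) \<in> JN_ziggurat"
      using am by (intro subsetD[OF sub(1)]) (auto simp: box_def)
    with 1 m am show thesis by (intro that[of a m "1 / of_int m"]) (auto simp: box_def)
  next
    assume 2: "(x, y, z) \<in> box (of_int a / of_int m) (1 / of_int m) (of_int (m - a) / of_int m)"
    then have "(x, y, of_int (m - a) / of_int m) \<in> JN_ziggurat"
      using am by (intro subsetD[OF sub(2)]) (auto simp: box_def)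
    with 2 m am show thesis by (intro that[of a m "of_int (m - a) / of_int m"]) (auto simp: box_def)
  next
    assume 3: "(x, y, z) \<in> box (1 / of_int m) (of_int a / of_int m) (of_int (m - a) / of_int m)"
    then have "(x, y, of_int (m - a) / of_int m) \<in> JN_ziggurat"
      using am by (intro subsetD[OF sub(3)]) (auto simp: box_def)
    with 3 m am show thesis by (intro that[of a m "of_int (m - a) / of_int m"]) (auto simp: box_def)
  qed
qed

lemma JN_ziggurat_lower:
  assumes "(x, y, c) \<in> JN_ziggurat" "0 \<le> z" "z \<le> c"
  shows "(x, y, z) \<in> JN_ziggurat"
proof -
  obtain a m :: int where am: "0 < a" "a < m" "coprime a m"
    and "(x, y, c) \<in> box (of_int a / of_int m) (of_int (m - a) / of_int m) (1 / of_int m)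
      \<union> box (of_int a / of_int m) (1 / of_int m) (of_int (m - a) / of_int m)
      \<union> box (1 / of_int m) (of_int a / of_int m) (of_int (m - a) / of_int m)"
    using assms(1) unfolding JN_ziggurat_def by blast
  then have "(x, y, z) \<in> box (of_int a / of_int m) (of_int (m - a) / of_int m) (1 / of_int m)
      \<union> box (of_int a / of_int m) (1 / of_int m) (of_int (m - a) / of_int m)
      \<union> box (1 / of_int m) (of_int a / of_int m) (of_int (m - a) / of_int m)"
    using assms by (auto simp: box_def)
  then show ?thesis using box_subset_JN_ziggurat[OF am] by blast
qed

text \<open>Each \<open>t\<close> just below \<open>z\<close> lies under a box top from one finite
  set, so the largest such top is at least \<open>z\<close>.\<close>

lemma JN_ziggurat_limit:
  assumes "0 < x" "0 < y" "0 < z" and below: "\<And>t. 0 < t \<Longrightarrow> t < z \<Longrightarrow> (x, y, t) \<in> JN_ziggurat"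
  shows "(x, y, z) \<in> JN_ziggurat"
proof -
  \<comment> \<open>Halving \<open>z\<close> lets one \<open>e\<close> serve for all heights between
    \<open>z / 2\<close> and \<open>z\<close>.\<close>
  define e where "e = min x (min y (z / 2))"
  \<comment> \<open>A finite superset of the box tops that can occur; at \<open>m = 0\<close> both
    quotients are 0 by convention.\<close>
  define H :: "real set" where
    "H = (\<Union>a\<in>{0..\<lceil>1 / e\<rceil>}. \<Union>m\<in>{0..\<lceil>1 / e\<rceil>}. {1 / of_int m, of_int (m - a) / of_int m})"
  define T where "T = {c \<in> H. (x, y, c) \<in> JN_ziggurat}"
  have fin: "finite T" by (simp add: T_def H_def)
  have e: "0 < e" "e \<le> x" "e \<le> y" "e \<le> z / 2" using assms by (auto simp: e_def)
  have ex: "\<exists>c\<in>T. t \<le> c" if t: "z / 2 \<le> t" "t < z" for t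
  proof -
    have "(x, y, t) \<in> JN_ziggurat" using below t assms by simp
    moreover have "e \<le> t" using e t by linarith
    ultimately obtain a m c where
      "a \<in> {0..\<lceil>1 / e\<rceil>}" "m \<in> {0..\<lceil>1 / e\<rceil>}"
      "c \<in> {1 / real_of_int m, of_int (m - a) / of_int m}" "t \<le> c" "(x, y, c) \<in> JN_ziggurat"
      by (rule JN_ziggurat_raise[OF _ e(1-3)])
    then show ?thesis unfolding T_def H_def by blast
  qed
  have ne: "T \<noteq> {}" using ex[of "z / 2"] assms by auto
  have "z \<le> Max T"
  proof (rule dense_le_bounded[of "z / 2"])
    fix t assume "z / 2 < t" "t < z"
    then show "t \<le> Max T" using ex[of t] Max_ge[OF fin] by force
  qed (use assms in simp)
  moreover have "(x, y, Max T) \<in> JN_ziggurat" using Max_in[OF fin ne] by (simp add: T_def)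
  ultimately show ?thesis using JN_ziggurat_lower assms by (meson less_imp_le)
qed

section \<open>The reverse inclusion and the coordinate planes\<close>

lemma unit_excess_box_subset_ziggurat:
  fixes u v w q :: int
  assumes "u < q" "v < q" "w < q" "0 < q" "u + v + w = q + 1"
  shows "box (of_int u / of_int q) (of_int v / of_int q) (of_int w / of_int q) \<subseteq> ziggurat"
proof
  fix p assume "p \<in> box (of_int u / of_int q) (of_int v / of_int q) (of_int w / of_int q)"
  then obtain x y z where p: "p = (x, y, z)" and pos: "0 \<le> x" "0 \<le> y" "0 \<le> z"
    and le: "x \<le> u / of_int q" "y \<le> v / of_int q" "z \<le> w / of_int q" by (auto simp: box_def)
  have "u / of_int q < (1::real)" "v / of_int q < (1::real)" "w / of_int q < (1::real)"
    using assms by simp_all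
  then have "x < 1" "y < 1" "z < 1" using le by linarith+
  moreover have "q + 1 - u - v = w" using assms by simp
  ultimately show "p \<in> ziggurat"
    using R_ab_ge[OF assms(4) le(1,2)] le pos by (auto simp: ziggurat_def p)
qed

text \<open>The numerators \<open>a\<close>, \<open>m - a\<close> and 1 sum to \<open>m + 1\<close>,
  and each is less than \<open>m\<close>.\<close>

lemma JN_ziggurat_subset_ziggurat: "JN_ziggurat \<subseteq> ziggurat"
proof -
  have "box (of_int a / of_int m) (of_int (m - a) / of_int m) (1 / of_int m)
     \<union> box (of_int a / of_int m) (1 / of_int m) (of_int (m - a) / of_int m)
     \<union> box (1 / of_int m) (of_int a / of_int m) (of_int (m - a) / of_int m) \<subseteq> ziggurat"
    if "0 < a" "a < m" for a m :: int
    using unit_excess_box_subset_ziggurat[of a m "m - a" 1]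
      unit_excess_box_subset_ziggurat[of a m 1 "m - a"]
      unit_excess_box_subset_ziggurat[of 1 m a "m - a"] that by simp
  then show ?thesis unfolding JN_ziggurat_def by blast
qed

text \<open>Denominator 1 suffices: \<open>(u, v)\<close> equal to (0, 1) or (1, 0) allows heights
  up to 1 when \<open>x\<close> or \<open>y\<close> vanishes, and (1, 1) allows height 0.\<close>

lemma coordinate_planes_subset_ziggurat:
  assumes "(x, y, z) \<in> {0..<1} \<times> {0..<1} \<times> {0..<1}" "x = 0 \<or> y = 0 \<or> z = 0"
  shows "(x, y, z) \<in> ziggurat"
  using assms R_ab_ge[of 1 x 0 y 1] R_ab_ge[of 1 x 1 y 0] R_ab_ge[of 1 x 1 y 1]
  by (auto simp: ziggurat_def)

theorem mainTheorem3:
  shows "ziggurat = JN_ziggurat \<union>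
    {(x, y, z). (x, y, z) \<in> {0..<1} \<times> {0..<1} \<times> {0..<1} \<and> (x = 0 \<or> y = 0 \<or> z = 0)}"
proof (intro equalityI subsetI)
  fix p assume p: "p \<in> ziggurat"
  obtain x y z where xyz: "p = (x, y, z)" by (cases p)
  show "p \<in> JN_ziggurat \<union>
    {(x, y, z). (x, y, z) \<in> {0..<1} \<times> {0..<1} \<times> {0..<1} \<and> (x = 0 \<or> y = 0 \<or> z = 0)}"
  proof (cases "x = 0 \<or> y = 0 \<or> z = 0")
    case False
    then have *: "0 < x" "0 < y" "0 < z" "z \<le> R_ab (1 - x) (1 - y) - 1"
      using p by (auto simp: ziggurat_def xyz)
    \<comment> \<open>Every \<open>t < z\<close> is strictly below the supremum bound, and the limit
      lemma then recovers \<open>z\<close> itself.\<close>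
    then have "(x, y, z) \<in> JN_ziggurat"
      by (intro JN_ziggurat_limit[OF *(1-3)] in_JN_ziggurat_if_less[OF *(1,2)]) simp_all
    then show ?thesis by (simp add: xyz)
  next
    case True
    moreover have "(x, y, z) \<in> {0..<1} \<times> {0..<1} \<times> {0..<1}"
      using p by (simp add: ziggurat_def xyz)
    ultimately show ?thesis unfolding xyz by blast
  qed
next
  fix p assume "p \<in> JN_ziggurat \<union>
    {(x, y, z). (x, y, z) \<in> {0..<1} \<times> {0..<1} \<times> {0..<1} \<and> (x = 0 \<or> y = 0 \<or> z = 0)}"
  then show "p \<in> ziggurat"
    using JN_ziggurat_subset_ziggurat coordinate_planes_subset_ziggurat by blast
qed

end
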